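(* Let $L$ be a closed braid diagram, representing a transverse link in $(S^3,\xi_{std})$ with self-linking number $sl(L)$. Then $\psi(L)\in Kh^{0,sl(L)}(L)$.
   Context: **Transverse links and braids.** $\xi_{std}=\ker(dz-y\,dx+x\,dy)$ is the standard contact structure on $S^3$; closed braids around the $z$-axis represent transverse links. Braids on $b$ strings are words in $\sigma_1^{\pm1},\dots,\sigma_{b-1}^{\pm1}$; $\sigma_i$ gives a positive crossing between strings $i$ and $i+1$, and $\sigma_i^{-1}$ a negative one. For a closed braid $L$ with braid index $b$ and $n_+$ positive and $n_-$ negative crossings, the self-linking number is $sl(L)=-b+n_+-n_-$. **Khovanov complex (coefficients in $\mathbb{Z}$).** Let $L$ be an oriented link diagram with $n=n_++n_-$ crossings ($n_\pm$ positive/negative ones). Each crossing has a 0-resolution and a 1-resolution: the 0-resolution joins the two regions swept out when the overcrossing strand is rotated counterclockwise; in particular the oriented resolution of a positive crossing is its 0-resolution and the oriented resolution of a negative crossing is its 1-resolution. For $v\in\{0,1\}^n$ let $L_v$ be the corresponding complete resolution, a union of planar circles. Let $U$ be the free $\mathbb{Z}$-module with basis ${\bf u}_-,{\bf u}_+$, graded by $p({\bf u}_\pm)=\pm1$. If $L_v$ has $k$ circles put $CKh(L_v)=U^{\otimes k}$ (one factor per circle), and $CKh(L)=\bigoplus_v CKh(L_v)$. Homological grading: $\mathrm{gr}=|v|-n_-$, with $|v|$ the number of 1's in $v$; quantum grading: $q=p+\mathrm{gr}+n_+-n_-$. The differential on $CKh(L_v)$ is $d=\sum_e(-1)^{s(e)}d_e$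 over edges $e$ of the cube $[0,1]^n$ with initial vertex $v$ (one coordinate changes from 0 to 1), where $d_e$ is $m$ on the factors of two circles that merge, or $\Delta$ on the factor of a circle that splits (identity on other factors): $m({\bf u}_+\otimes{\bf u}_+)={\bf u}_+$, $m({\bf u}_+\otimes{\bf u}_-)=m({\bf u}_-\otimes{\bf u}_+)={\bf u}_-$, $m({\bf u}_-\otimes{\bf u}_-)=0$; $\Delta({\bf u}_+)={\bf u}_+\otimes{\bf u}_-+{\bf u}_-\otimes{\bf u}_+$, $\Delta({\bf u}_-)={\bf u}_-\otimes{\bf u}_-$. The signs are chosen so that $d^2=0$ (all choices give isomorphic complexes). $Kh(L)$ is the bigraded homology, $Kh^{i,j}(L)$ the part with $\mathrm{gr}=i$, $q=j$. **The element $\psi(L)$.** For a closed braid diagram $L$ on $b$ strings let $L_o$ be the oriented resolution (0-resolution at positive crossings, 1-resolution at negative crossings), which consists of $b$ parallel circles. Put $\tilde\psi(L)={\bf u}_-\otimes\cdots\otimes{\bf u}_-\in U^{\otimes b}=CKh(L_o)$. It is a cycle, and $\psi(L)\in Kh(L)$ is its homology class. *)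

theory Defs
  imports "HOL-Algebra.Free_Abelian_Groups"
begin

datatype braid_letter = is_positive: Sigma (strand: nat) | SigmaInv (strand: nat)

text \<open>A closed braid diagram is given by its number \<open>b\<close> of strings and a braid word \<open>w\<close> on
  \<open>b\<close> strings; the closure of the word is built into \<open>joined\<close> below. Strings are numbered from 1,
  the crossings are numbered \<open>0, \<dots>, length w - 1\<close> along the word.\<close>

definition braid_word :: "nat \<Rightarrow> braid_letter list \<Rightarrow> bool" where
  "braid_word b w \<longleftrightarrow> (\<forall>g\<in>set w. 1 \<le> strand g \<and> strand g < b)"

definition n_plus :: "braid_letter list \<Rightarrow> nat" where
  "n_plus w = length (filter is_positive w)"

definition n_minus :: "braid_letter list \<Rightarrow> nat" where
  "n_minus w = length (filter (\<lambda>g. \<not> is_positive g) w)"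

definition self_linking :: "nat \<Rightarrow> braid_letter list \<Rightarrow> int" where
  "self_linking b w = - int b + int (n_plus w) - int (n_minus w)"


subsection \<open>Complete resolutions and their circles\<close>

text \<open>A vertex \<open>v\<close> of the cube is a list of booleans of the same length as \<open>w\<close>, \<open>True\<close> standing
  for 1. The oriented resolution is the 0-resolution of a positive crossing and the 1-resolution of
  a negative one.\<close>

definition oriented_at :: "braid_letter list \<Rightarrow> bool list \<Rightarrow> nat \<Rightarrow> bool" where
  "oriented_at w v k \<longleftrightarrow> is_positive (w ! k) \<noteq> v ! k"

text \<open>The diagram is cut along the levels \<open>0, \<dots>, length w\<close>, crossing \<open>k\<close> lying between the levels
  \<open>k\<close> and \<open>k + 1\<close>; the point \<open>(k, j)\<close> is the intersection of level \<open>k\<close> with the string in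
  position \<open>j\<close>. The relation \<open>joined b w v\<close> lists the arcs of the resolution between adjacent
  points; the rule \<open>closing\<close> closes up the braid.\<close>

definition points :: "nat \<Rightarrow> braid_letter list \<Rightarrow> (nat \<times> nat) set" where
  "points b w = {0..length w} \<times> {1..b}"

inductive joined :: "nat \<Rightarrow> braid_letter list \<Rightarrow> bool list \<Rightarrow> nat \<times> nat \<Rightarrow> nat \<times> nat \<Rightarrow> bool"
  for b w v where
  closing: "1 \<le> j \<Longrightarrow> j \<le> b \<Longrightarrow> joined b w v (length w, j) (0, j)"
| away: "k < length w \<Longrightarrow> 1 \<le> j \<Longrightarrow> j \<le> b \<Longrightarrow> j \<noteq> strand (w ! k) \<Longrightarrow> j \<noteq> Suc (strand (w ! k)) \<Longrightarrow>
    joined b w v (k, j) (Suc k, j)"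
| oriented: "k < length w \<Longrightarrow> oriented_at w v k \<Longrightarrow> j = strand (w ! k) \<or> j = Suc (strand (w ! k)) \<Longrightarrow>
    joined b w v (k, j) (Suc k, j)"
| turnback: "k < length w \<Longrightarrow> \<not> oriented_at w v k \<Longrightarrow> l = k \<or> l = Suc k \<Longrightarrow>
    joined b w v (l, strand (w ! k)) (l, Suc (strand (w ! k)))"

text \<open>A circle is represented by the set of points lying on it.\<close>

definition circle_of :: "nat \<Rightarrow> braid_letter list \<Rightarrow> bool list \<Rightarrow> nat \<times> nat \<Rightarrow> (nat \<times> nat) set" where
  "circle_of b w v P = {Q \<in> points b w. equivclp (joined b w v) P Q}"

definition circles :: "nat \<Rightarrow> braid_letter list \<Rightarrow> bool list \<Rightarrow> (nat \<times> nat) set set" where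
  "circles b w v = circle_of b w v ` points b w"


subsection \<open>The Khovanov complex\<close>

datatype label = Uminus | Uplus

text \<open>The module \<open>U\<close> tensored over a set of circles is the free abelian group on the labellings
  of these circles by \<open>Uminus\<close> and \<open>Uplus\<close>: a labelling stands for the tensor product of its
  values.\<close>

type_synonym state = "bool list \<times> ((nat \<times> nat) set \<Rightarrow> label)"

definition states :: "nat \<Rightarrow> braid_letter list \<Rightarrow> state set" where
  "states b w = (SIGMA v : {v. length v = length w}. circles b w v \<rightarrow>\<^sub>E UNIV)"

definition CKh :: "nat \<Rightarrow> braid_letter list \<Rightarrow> (state \<Rightarrow>\<^sub>0 int) monoid" where
  "CKh b w = free_Abelian_group (states b w)"

fun label_degree :: "label \<Rightarrow> int" where
  "label_degree Uminus = -1"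
| "label_degree Uplus = 1"

fun p_degree :: "nat \<Rightarrow> braid_letter list \<Rightarrow> state \<Rightarrow> int" where
  "p_degree b w (v, x) = (\<Sum>C\<in>circles b w v. label_degree (x C))"

fun gr_degree :: "braid_letter list \<Rightarrow> state \<Rightarrow> int" where
  "gr_degree w (v, x) = int (length (filter id v)) - int (n_minus w)"

definition q_degree :: "nat \<Rightarrow> braid_letter list \<Rightarrow> state \<Rightarrow> int" where
  "q_degree b w e = p_degree b w e + gr_degree w e + int (n_plus w) - int (n_minus w)"

definition bihomogeneous ::
  "nat \<Rightarrow> braid_letter list \<Rightarrow> int \<Rightarrow> int \<Rightarrow> (state \<Rightarrow>\<^sub>0 int) \<Rightarrow> bool" where
  "bihomogeneous b w i j c \<longleftrightarrow>
     (\<forall>e\<in>Poly_Mapping.keys c. gr_degree w e = i \<and> q_degree b w e = j)"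

fun kh_mult :: "label \<Rightarrow> label \<Rightarrow> (label \<Rightarrow>\<^sub>0 int)" where
  "kh_mult Uplus Uplus = frag_of Uplus"
| "kh_mult Uplus Uminus = frag_of Uminus"
| "kh_mult Uminus Uplus = frag_of Uminus"
| "kh_mult Uminus Uminus = 0"

fun kh_comult :: "label \<Rightarrow> (label \<times> label \<Rightarrow>\<^sub>0 int)" where
  "kh_comult Uplus = frag_of (Uplus, Uminus) + frag_of (Uminus, Uplus)"
| "kh_comult Uminus = frag_of (Uminus, Uminus)"

text \<open>The map of the edge starting at \<open>v\<close> along which coordinate \<open>k\<close> changes from 0 to 1. With
  \<open>i = strand (w ! k)\<close>, the points \<open>(k, i)\<close> and \<open>(k + 1, i + 1)\<close> are diagonally opposite corners
  of crossing \<open>k\<close>, so in either resolution they lie on the two different arcs at that crossing. If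
  they are on different circles of \<open>v\<close>, these merge; otherwise their common circle splits. All
  other circles are the same sets of points in both resolutions.\<close>

fun edge_map :: "nat \<Rightarrow> braid_letter list \<Rightarrow> nat \<Rightarrow> state \<Rightarrow> (state \<Rightarrow>\<^sub>0 int)" where
  "edge_map b w k (v, x) =
    (let v' = v[k := True];
         P = (k, strand (w ! k));
         Q = (Suc k, Suc (strand (w ! k)));
         C = circle_of b w v;
         C' = circle_of b w v';
         basis = (\<lambda>y. frag_of (v', restrict y (circles b w v')))
     in if C P \<noteq> C Q
        then frag_extend (\<lambda>z. basis (x(C' P := z))) (kh_mult (x (C P)) (x (C Q)))
        else frag_extend (\<lambda>(z, z'). basis (x(C' P := z, C' Q := z'))) (kh_comult (x (C P))))"

text \<open>\<open>s v k\<close> is the sign exponent of the edge starting at \<open>v\<close> in direction \<open>k\<close>.\<close>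

definition differential ::
  "nat \<Rightarrow> braid_letter list \<Rightarrow> (bool list \<Rightarrow> nat \<Rightarrow> nat) \<Rightarrow> (state \<Rightarrow>\<^sub>0 int) \<Rightarrow> (state \<Rightarrow>\<^sub>0 int)" where
  "differential b w s =
     frag_extend (\<lambda>(v, x). \<Sum>k | k < length w \<and> \<not> v ! k.
       frag_cmul ((-1) ^ s v k) (edge_map b w k (v, x)))"

definition sign_choice ::
  "nat \<Rightarrow> braid_letter list \<Rightarrow> (bool list \<Rightarrow> nat \<Rightarrow> nat) \<Rightarrow> bool" where
  "sign_choice b w s \<longleftrightarrow>
     (\<forall>c\<in>carrier (CKh b w). differential b w s (differential b w s c) = 0)"


subsection \<open>Khovanov homology\<close>

definition kh_cycles ::
  "nat \<Rightarrow> braid_letter list \<Rightarrow> (bool list \<Rightarrow> nat \<Rightarrow> nat) \<Rightarrow> (state \<Rightarrow>\<^sub>0 int) set" where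
  "kh_cycles b w s = {c \<in> carrier (CKh b w). differential b w s c = 0}"

definition kh_boundaries ::
  "nat \<Rightarrow> braid_letter list \<Rightarrow> (bool list \<Rightarrow> nat \<Rightarrow> nat) \<Rightarrow> (state \<Rightarrow>\<^sub>0 int) set" where
  "kh_boundaries b w s = differential b w s ` carrier (CKh b w)"

definition Kh ::
  "nat \<Rightarrow> braid_letter list \<Rightarrow> (bool list \<Rightarrow> nat \<Rightarrow> nat) \<Rightarrow> (state \<Rightarrow>\<^sub>0 int) set monoid" where
  "Kh b w s = subgroup_generated (CKh b w) (kh_cycles b w s) Mod kh_boundaries b w s"

text \<open>The part of \<open>Kh b w s\<close> in homological degree \<open>i\<close> and quantum degree \<open>j\<close>: the homology
  classes containing a cycle of bidegree \<open>(i, j)\<close>.\<close>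

definition Kh_part ::
  "nat \<Rightarrow> braid_letter list \<Rightarrow> (bool list \<Rightarrow> nat \<Rightarrow> nat) \<Rightarrow> int \<Rightarrow> int \<Rightarrow> (state \<Rightarrow>\<^sub>0 int) set set" where
  "Kh_part b w s i j = {X \<in> carrier (Kh b w s). \<exists>c\<in>X. bihomogeneous b w i j c}"


subsection \<open>The element \<open>\<psi>\<close>\<close>

definition oriented_vertex :: "braid_letter list \<Rightarrow> bool list" where
  "oriented_vertex w = map (\<lambda>g. \<not> is_positive g) w"

definition psi_chain :: "nat \<Rightarrow> braid_letter list \<Rightarrow> (state \<Rightarrow>\<^sub>0 int)" where
  "psi_chain b w = frag_of (oriented_vertex w, \<lambda>C\<in>circles b w (oriented_vertex w). Uminus)"

definition psi ::
  "nat \<Rightarrow> braid_letter list \<Rightarrow> (bool list \<Rightarrow> nat \<Rightarrow> nat) \<Rightarrow> (state \<Rightarrow>\<^sub>0 int) set" where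
  "psi b w s = kh_boundaries b w s #>\<^bsub>CKh b w\<^esub> psi_chain b w"

end

theory Submission
  imports Defs
begin

text \<open>Every arc of the oriented resolution stays in its string position, so its circles are the \<open>b\<close>
  parallel strings. Hence the chain labelling all of them by \<open>Uminus\<close> has \<open>p = - b\<close>, and each edge
  leaving the oriented vertex merges two different strings and kills the chain, because
  \<open>m(u\<^sub>- \<otimes> u\<^sub>-) = 0\<close>.\<close>

lemma length_oriented_vertex [simp]: "length (oriented_vertex w) = length w"
  by (simp add: oriented_vertex_def)

lemma oriented_at_oriented_vertex [simp]:
  "k < length w \<Longrightarrow> oriented_at w (oriented_vertex w) k"
  by (simp add: oriented_at_def oriented_vertex_def)

text \<open>\<open>turnback\<close> is the only rule that changes the position, and its premise
  fails at every crossing of this vertex.\<close>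

lemma joined_oriented_vertex_snd_eq:
  "joined b w (oriented_vertex w) P Q \<Longrightarrow> snd P = snd Q"
  by (induction rule: joined.induct) auto

lemma equivclp_joined_oriented_vertex_snd_eq:
  "equivclp (joined b w (oriented_vertex w)) P Q \<Longrightarrow> snd P = snd Q"
  by (induction rule: equivclp_induct) (auto dest: joined_oriented_vertex_snd_eq)

lemma equivclp_joined_oriented_vertex_base:
  assumes "1 \<le> j" "j \<le> b" "k \<le> length w"
  shows "equivclp (joined b w (oriented_vertex w)) (0, j) (k, j)"
  using assms(3)
proof (induction k)
  case 0
  show ?case by simp
next
  case (Suc k)
  then have "k < length w" by simp
  \<comment> \<open>Positions at crossing \<open>k\<close> climb by \<open>oriented\<close>, the
    others by \<open>away\<close>.\<close>
  then have "joined b w (oriented_vertex w) (k, j) (Suc k, j)"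
    using assms by (cases "j = strand (w ! k) \<or> j = Suc (strand (w ! k))")
      (auto intro: joined.away joined.oriented)
  with Suc show ?case
    by (meson Suc_leD equivclp_into_equivclp)
qed

text \<open>Two points in the same position are linked through the point at level 0; conversely,
  equivalence preserves the position.\<close>

lemma circle_of_oriented_vertex:
  assumes "P \<in> points b w"
  shows "circle_of b w (oriented_vertex w) P = {0..length w} \<times> {snd P}"
proof -
  have "equivclp (joined b w (oriented_vertex w)) P (k, snd P)" if "k \<le> length w" for k
    using equivclp_joined_oriented_vertex_base[of "snd P" b "fst P" w]
      equivclp_joined_oriented_vertex_base[of "snd P" b k w] assms that
    by (auto simp: points_def) (meson equivclp_sym equivclp_trans)
  then show ?thesis
    using assms
    by (auto simp: circle_of_def points_def dest: equivclp_joined_oriented_vertex_snd_eq)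
qed

lemma card_circles_oriented_vertex: "card (circles b w (oriented_vertex w)) = b"
proof -
  have "circles b w (oriented_vertex w) = (\<lambda>P. {0..length w} \<times> {snd P}) ` points b w"
    by (auto simp: circles_def circle_of_oriented_vertex)
  also have "\<dots> = (\<lambda>j. {0..length w} \<times> {j}) ` snd ` points b w"
    by (simp add: image_image)
  also have "snd ` points b w = {1..b}"
    by (simp add: points_def)
  finally have "circles b w (oriented_vertex w) = (\<lambda>j. {0..length w} \<times> {j}) ` {1..b}" .
  \<comment> \<open>Level 0 exists even for the empty word, so each product determines
    \<open>j\<close>.\<close>
  moreover have "inj_on (\<lambda>j. {0..length w} \<times> {j}) {1..b}"
    by (auto simp: inj_on_def times_eq_iff)
  ultimately show ?thesis
    by (simp add: card_image)
qed

lemma psi_chain_in_carrier: "psi_chain b w \<in> carrier (CKh b w)"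
  by (simp add: psi_chain_def CKh_def states_def)

lemma edge_map_oriented_vertex_Uminus:
  assumes "braid_word b w" "k < length w"
  shows "edge_map b w k
    (oriented_vertex w, \<lambda>C\<in>circles b w (oriented_vertex w). Uminus) = 0"
proof -
  let ?P = "(k, strand (w ! k))" and ?Q = "(Suc k, Suc (strand (w ! k)))"
  have "1 \<le> strand (w ! k)" "strand (w ! k) < b"
    using assms by (auto simp: braid_word_def)
  then have *: "?P \<in> points b w" "?Q \<in> points b w"
    using assms by (auto simp: points_def)
  then have "circle_of b w (oriented_vertex w) ?P \<noteq> circle_of b w (oriented_vertex w) ?Q"
    by (simp add: circle_of_oriented_vertex times_eq_iff)
  \<comment> \<open>The restricted labelling takes the value \<open>Uminus\<close> only on members
    of \<open>circles\<close>; elsewhere it is \<open>undefined\<close>.\<close>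
  moreover have "circle_of b w (oriented_vertex w) ?P \<in> circles b w (oriented_vertex w)"
    "circle_of b w (oriented_vertex w) ?Q \<in> circles b w (oriented_vertex w)"
    using * by (auto simp: circles_def)
  ultimately show ?thesis
    by (simp add: Let_def)
qed

lemma differential_psi_chain:
  assumes "braid_word b w"
  shows "differential b w s (psi_chain b w) = 0"
  using assms
  \<comment> \<open>The edge maps must stay folded for the vanishing lemma to rewrite them.\<close>
  by (simp add: differential_def psi_chain_def edge_map_oriented_vertex_Uminus del: edge_map.simps)

text \<open>The 1s of the oriented vertex mark exactly the negative crossings, so \<open>gr\<close>
  is 0 and only \<open>p\<close> and the writhe contribute to \<open>q\<close>.\<close>

lemma bihomogeneous_psi_chain: "bihomogeneous b w 0 (self_linking b w) (psi_chain b w)"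
proof -
  have "length (filter id (oriented_vertex w)) = n_minus w"
    by (simp add: oriented_vertex_def n_minus_def filter_map comp_def)
  then show ?thesis
    by (simp add: bihomogeneous_def psi_chain_def q_degree_def self_linking_def
        card_circles_oriented_vertex)
qed

text \<open>This supplies the bihomogeneous representative that \<open>Kh_part\<close> asks for; 0
  is a boundary, being the image of 0.\<close>

lemma psi_chain_in_psi: "psi_chain b w \<in> psi b w s"
proof -
  have "0 \<in> kh_boundaries b w s"
    unfolding kh_boundaries_def
    by (rule image_eqI[of _ _ 0]) (simp_all add: differential_def CKh_def)
  then show ?thesis
    by (force simp: psi_def r_coset_def CKh_def)
qed

lemma psi_in_carrier_Kh:
  assumes "braid_word b w"
  shows "psi b w s \<in> carrier (Kh b w s)"
proof -
  \<comment> \<open>\<open>subgroup_generated\<close> takes its generators from this intersection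
    and keeps the addition of \<open>CKh\<close>, so cosets formed in either group agree.\<close>
  have "psi_chain b w \<in> carrier (CKh b w) \<inter> kh_cycles b w s"
    using assms by (simp add: kh_cycles_def psi_chain_in_carrier differential_psi_chain)
  then have "psi_chain b w \<in> carrier (subgroup_generated (CKh b w) (kh_cycles b w s))"
    by (simp add: carrier_subgroup_generated generate.incl)
  then show ?thesis
    by (auto simp: psi_def Kh_def FactGroup_def RCOSETS_def r_coset_def)
qed

theorem proposition2:
  fixes b :: nat
    and w :: "braid_letter list"
    and s :: "bool list \<Rightarrow> nat \<Rightarrow> nat"
  assumes "b \<ge> 1" and "braid_word b w" and "sign_choice b w s"
  shows "psi b w s \<in> Kh_part b w s 0 (self_linking b w)"
  unfolding Kh_part_def
  using psi_in_carrier_Kh[OF assms(2)] psi_chain_in_psi bihomogeneous_psi_chain by blast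

end
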